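(* Let $\mathcal{M}=\mathcal{M}(\Sigma,I)$ be a trace monoid acting partially and irreducibly on a finite set $X_0$, and let $t_0$ be its characteristic root. Let $\mu(t)$ be the $X_0\times X_0$ matrix of polynomials $\mu_{\alpha,\beta}(t)=\sum_{\gamma\in\mathscr{C}\cap\mathcal{M}_{\alpha,\beta}}(-1)^{|\gamma|}t^{|\gamma|}$ and $\theta(t)=\det\mu(t)\in\mathbb{Z}[t]$. Then $t_0$ is the smallest positive root of $\theta$.
   Context: Trace monoid: $\Sigma$ finite, $|\Sigma|\ge2$, $I$ irreflexive symmetric, $\mathcal{M}=\Sigma^*/\langle ab=ba,\ (a,b)\in I\rangle$, unit $1$, length $|x|$. Cliques: traces $a_1\cdots a_k$ ($k\ge0$) of pairwise distinct letters pairwise in $I$; $\mathscr{C}$ the set of cliques; $c\parallel c'$ if $c\cdot c'$ is a clique. A partial action: nonempty $\Sigma(\alpha)\subseteq\Sigma$ for $\alpha\in X_0$ and maps $a\in\Sigma(\alpha)\mapsto\alpha\cdot a\in X_0$ such that if $a\in\Sigma(\alpha)$ and $a\parallel b$, then either $b\in\Sigma(\alpha)$ and $a\in\Sigma(\alpha\cdot b)$, $b\in\Sigma(\alpha\cdot a)$, $(\alpha\cdot a)\cdot b=(\alpha\cdot b)\cdot a$; or $b\notin\Sigma(\alpha)$ and $b\notin\Sigma(\alpha\cdot a)$. Its total action is the unique right action on $X_0\cup\{\bot\}$ extending these maps with $\alpha\cdot a=\bot$ for $a\notin\Sigma(\alpha)$, $\bot\cdot a=\bot$. $\mathcal{M}_\alpha=\{x:\alpha\cdot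 x\ne\bot\}$, $\mathcal{M}_{\alpha,\beta}=\{x:\alpha\cdot x=\beta\}$. A sub-action is a nonempty $Y\subseteq X_0$ with $\alpha\cdot a\in Y$ for all $\alpha\in Y$, $a\in\Sigma(\alpha)$; the action is irreducible if $X_0$ contains no sub-action other than $X_0$. Let $Z_\alpha(t)=\sum_{x\in\mathcal{M}_\alpha}t^{|x|}$ with radius of convergence $t_\alpha$; for an irreducible action $t_\alpha$ does not depend on $\alpha$, and this common value is the characteristic root $t_0$. *)

theory Defs
  imports "HOL-Analysis.Analysis" "HOL-Algebra.Group"
begin

text \<open>
  The alphabet is the finite type \<open>'a\<close>, the set acted upon is the finite type \<open>'x\<close>.
  A trace is a congruence class of words, i.e. an element of type \<open>'a list set\<close>.
\<close>

inductive trace_eq :: "('a \<times> 'a) set \<Rightarrow> 'a list \<Rightarrow> 'a list \<Rightarrow> bool" for I where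
  trace_eq_refl: "trace_eq I u u"
| trace_eq_sym: "trace_eq I u v \<Longrightarrow> trace_eq I v u"
| trace_eq_trans: "trace_eq I u v \<Longrightarrow> trace_eq I v w \<Longrightarrow> trace_eq I u w"
| trace_eq_append: "trace_eq I u u' \<Longrightarrow> trace_eq I v v' \<Longrightarrow> trace_eq I (u @ v) (u' @ v')"
| trace_eq_commute: "(a, b) \<in> I \<Longrightarrow> trace_eq I [a, b] [b, a]"

definition trace_of :: "('a \<times> 'a) set \<Rightarrow> 'a list \<Rightarrow> 'a list set" where
  "trace_of I u = {v. trace_eq I u v}"

definition trace_monoid :: "('a \<times> 'a) set \<Rightarrow> 'a list set monoid" where
  "trace_monoid I =
    \<lparr>carrier = range (trace_of I),
     mult = (\<lambda>x y. \<Union>u\<in>x. \<Union>v\<in>y. trace_of I (u @ v)),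
     one = trace_of I []\<rparr>"

text \<open>Congruent words have the same length, so the choice of representative is irrelevant;
  see \<open>trace_length_trace_of\<close> below.\<close>

definition trace_length :: "'a list set \<Rightarrow> nat" where
  "trace_length x = length (SOME u. u \<in> x)"

definition cliques :: "('a \<times> 'a) set \<Rightarrow> 'a list set set" where
  "cliques I = {trace_of I w |w. distinct w \<and> (\<forall>a\<in>set w. \<forall>b\<in>set w. a \<noteq> b \<longrightarrow> (a, b) \<in> I)}"

definition parallel :: "('a \<times> 'a) set \<Rightarrow> 'a list set \<Rightarrow> 'a list set \<Rightarrow> bool" where
  "parallel I c c' \<longleftrightarrow> c \<otimes>\<^bsub>trace_monoid I\<^esub> c' \<in> cliques I"

text \<open>
  A family of partial maps is given by \<open>\<delta> :: 'x \<Rightarrow> 'a \<rightharpoonup> 'x\<close>: the set of letters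
  \<open>\<Sigma>(\<alpha>)\<close> enabled at \<open>\<alpha>\<close> is \<open>dom (\<delta> \<alpha>)\<close>, and \<open>\<alpha> \<cdot> a\<close> is \<open>the (\<delta> \<alpha> a)\<close>
  for \<open>a \<in> dom (\<delta> \<alpha>)\<close>.
\<close>

definition partial_action :: "('a \<times> 'a) set \<Rightarrow> ('x \<Rightarrow> 'a \<rightharpoonup> 'x) \<Rightarrow> bool" where
  "partial_action I \<delta> \<longleftrightarrow>
    (\<forall>\<alpha>. dom (\<delta> \<alpha>) \<noteq> {}) \<and>
    (\<forall>\<alpha> a b. a \<in> dom (\<delta> \<alpha>) \<longrightarrow> parallel I (trace_of I [a]) (trace_of I [b]) \<longrightarrow>
      (b \<in> dom (\<delta> \<alpha>) \<and> a \<in> dom (\<delta> (the (\<delta> \<alpha> b))) \<and> b \<in> dom (\<delta> (the (\<delta> \<alpha> a))) \<and>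
        the (\<delta> (the (\<delta> \<alpha> a)) b) = the (\<delta> (the (\<delta> \<alpha> b)) a))
      \<or> (b \<notin> dom (\<delta> \<alpha>) \<and> b \<notin> dom (\<delta> (the (\<delta> \<alpha> a)))))"

definition letter_step :: "('x \<Rightarrow> 'a \<rightharpoonup> 'x) \<Rightarrow> 'x option \<Rightarrow> 'a \<Rightarrow> 'x option" where
  "letter_step \<delta> \<xi> a = Option.bind \<xi> (\<lambda>\<alpha>. \<delta> \<alpha> a)"

text \<open>
  The total action, with \<open>None\<close> in the role of \<open>\<bottom>\<close>, computed on a representative word. For a
  partial action it is the unique right action of the trace monoid on \<open>'x option\<close> extending the
  given maps: see \<open>total_action_right_action\<close> and \<open>total_action_unique\<close> below.
\<close>

definition total_action :: "('x \<Rightarrow> 'a \<rightharpoonup> 'x) \<Rightarrow> 'x option \<Rightarrow> 'a list set \<Rightarrow> 'x option" where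
  "total_action \<delta> \<xi> x = foldl (letter_step \<delta>) \<xi> (SOME u. u \<in> x)"

definition traces_from :: "('a \<times> 'a) set \<Rightarrow> ('x \<Rightarrow> 'a \<rightharpoonup> 'x) \<Rightarrow> 'x \<Rightarrow> 'a list set set" where
  "traces_from I \<delta> \<alpha> = {x \<in> carrier (trace_monoid I). total_action \<delta> (Some \<alpha>) x \<noteq> None}"

definition traces_between ::
    "('a \<times> 'a) set \<Rightarrow> ('x \<Rightarrow> 'a \<rightharpoonup> 'x) \<Rightarrow> 'x \<Rightarrow> 'x \<Rightarrow> 'a list set set" where
  "traces_between I \<delta> \<alpha> \<beta> =
    {x \<in> carrier (trace_monoid I). total_action \<delta> (Some \<alpha>) x = Some \<beta>}"

definition sub_action :: "('x \<Rightarrow> 'a \<rightharpoonup> 'x) \<Rightarrow> 'x set \<Rightarrow> bool" where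
  "sub_action \<delta> Y \<longleftrightarrow> Y \<noteq> {} \<and> (\<forall>\<alpha>\<in>Y. \<forall>a\<in>dom (\<delta> \<alpha>). the (\<delta> \<alpha> a) \<in> Y)"

definition irreducible_action :: "('x \<Rightarrow> 'a \<rightharpoonup> 'x) \<Rightarrow> bool" where
  "irreducible_action \<delta> \<longleftrightarrow> (\<forall>Y. sub_action \<delta> Y \<longrightarrow> Y = UNIV)"

text \<open>The series \<open>\<Sum>x\<in>M\<^sub>\<alpha>. t ^ \<bar>x\<bar>\<close>, with the terms of equal degree collected.\<close>

definition growth_series ::
    "('a \<times> 'a) set \<Rightarrow> ('x \<Rightarrow> 'a \<rightharpoonup> 'x) \<Rightarrow> 'x \<Rightarrow> real fps" where
  "growth_series I \<delta> \<alpha> =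
    Abs_fps (\<lambda>n. of_nat (card {x \<in> traces_from I \<delta> \<alpha>. trace_length x = n}))"

definition characteristic_root :: "('a \<times> 'a) set \<Rightarrow> ('x \<Rightarrow> 'a \<rightharpoonup> 'x) \<Rightarrow> real" where
  "characteristic_root I \<delta> =
    (THE t. \<forall>\<alpha>. fps_conv_radius (growth_series I \<delta> \<alpha>) = ereal t)"

definition mu_matrix ::
    "('a \<times> 'a) set \<Rightarrow> ('x \<Rightarrow> 'a \<rightharpoonup> 'x) \<Rightarrow> int poly ^ 'x ^ 'x" where
  "mu_matrix I \<delta> = (\<chi> \<alpha> \<beta>.
    \<Sum>\<gamma>\<in>cliques I \<inter> traces_between I \<delta> \<alpha> \<beta>. monom ((-1) ^ trace_length \<gamma>) (trace_length \<gamma>))"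

definition theta :: "('a \<times> 'a) set \<Rightarrow> ('x::finite \<Rightarrow> 'a \<rightharpoonup> 'x) \<Rightarrow> int poly" where
  "theta I \<delta> = det (mu_matrix I \<delta>)"


subsection \<open>Well-definedness\<close>

lemma trace_eq_length: "trace_eq I u v \<Longrightarrow> length u = length v"
  by (induction rule: trace_eq.induct) auto

lemma trace_of_eq_iff: "trace_of I u = trace_of I v \<longleftrightarrow> trace_eq I u v"
proof
  assume "trace_of I u = trace_of I v"
  moreover have "v \<in> trace_of I v"
    by (simp add: trace_of_def trace_eq_refl)
  ultimately have "v \<in> trace_of I u"
    by simp
  then show "trace_eq I u v"
    by (simp add: trace_of_def)
next
  assume uv: "trace_eq I u v"
  have "trace_eq I u w \<longleftrightarrow> trace_eq I v w" for w
    using trace_eq_trans[OF uv] trace_eq_trans[OF trace_eq_sym[OF uv]] by iprover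
  then show "trace_of I u = trace_of I v"
    by (simp add: trace_of_def)
qed

lemma trace_eq_some: "trace_eq I u (SOME v. v \<in> trace_of I u)"
proof -
  have "(SOME v. v \<in> trace_of I u) \<in> trace_of I u"
    by (rule someI[of _ u]) (simp add: trace_of_def trace_eq_refl)
  then show ?thesis by (simp add: trace_of_def)
qed

lemma trace_length_trace_of: "trace_length (trace_of I w) = length w"
  unfolding trace_length_def by (rule trace_eq_length[OF trace_eq_some, symmetric])

lemma trace_mult_trace_of:
  "trace_of I u \<otimes>\<^bsub>trace_monoid I\<^esub> trace_of I v = trace_of I (u @ v)"
proof -
  have eq: "trace_of I (u' @ v') = trace_of I (u @ v)"
    if "u' \<in> trace_of I u" "v' \<in> trace_of I v" for u' v'
  proof -
    have "trace_eq I u u'" "trace_eq I v v'"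
      using that by (simp_all add: trace_of_def)
    then show ?thesis
      unfolding trace_of_eq_iff by (rule trace_eq_sym[OF trace_eq_append])
  qed
  have mem: "u \<in> trace_of I u" "v \<in> trace_of I v"
    by (simp_all add: trace_of_def trace_eq_refl)
  have "(\<Union>u'\<in>trace_of I u. \<Union>v'\<in>trace_of I v. trace_of I (u' @ v')) =
      (\<Union>u'\<in>trace_of I u. \<Union>v'\<in>trace_of I v. trace_of I (u @ v))"
    by (intro SUP_cong refl eq)
  also have "\<dots> = trace_of I (u @ v)"
    using mem by blast
  finally show ?thesis
    by (simp add: trace_monoid_def)
qed

lemma trace_monoid_is_monoid: "monoid (trace_monoid I)"
proof -
  have carrier: "carrier (trace_monoid I) = range (trace_of I)"
    and one: "\<one>\<^bsub>trace_monoid I\<^esub> = trace_of I []"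
    by (simp_all add: trace_monoid_def)
  show ?thesis
    by (rule monoidI) (auto simp: carrier one trace_mult_trace_of)
qed

lemma parallel_letters:
  assumes "(a, b) \<in> I" "sym I" "irrefl I"
  shows "parallel I (trace_of I [a]) (trace_of I [b])"
proof -
  have "a \<noteq> b" using assms(1,3) by (auto simp: irrefl_def)
  moreover have "(b, a) \<in> I" using assms(1,2) by (auto dest: symD)
  ultimately show ?thesis
    unfolding parallel_def trace_mult_trace_of cliques_def using assms(1)
    by (intro CollectI exI[of _ "[a] @ [b]"]) auto
qed

lemma foldl_letter_step_cong:
  assumes "partial_action I \<delta>" "sym I" "irrefl I" "trace_eq I u v"
  shows "foldl (letter_step \<delta>) \<xi> u = foldl (letter_step \<delta>) \<xi> v"
  using assms(4)
proof (induction arbitrary: \<xi> rule: trace_eq.induct)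
  case (trace_eq_commute a b)
  have par: "parallel I (trace_of I [a]) (trace_of I [b])"
            "parallel I (trace_of I [b]) (trace_of I [a])"
    using trace_eq_commute assms(2,3) by (auto intro!: parallel_letters dest: symD)
  have "letter_step \<delta> (\<delta> \<alpha> a) b = letter_step \<delta> (\<delta> \<alpha> b) a" for \<alpha>
  proof -
    have dom: "\<And>a b. parallel I (trace_of I [a]) (trace_of I [b]) \<Longrightarrow> \<delta> \<alpha> a \<noteq> None \<Longrightarrow>
        (\<delta> \<alpha> b \<noteq> None \<and> \<delta> (the (\<delta> \<alpha> a)) b \<noteq> None \<and> \<delta> (the (\<delta> \<alpha> b)) a \<noteq> None
          \<and> the (\<delta> (the (\<delta> \<alpha> a)) b) = the (\<delta> (the (\<delta> \<alpha> b)) a))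
        \<or> (\<delta> \<alpha> b = None \<and> \<delta> (the (\<delta> \<alpha> a)) b = None)"
      using assms(1) unfolding partial_action_def domIff by blast
    show ?thesis
      using dom[OF par(1)] dom[OF par(2)]
      by (cases "\<delta> \<alpha> a"; cases "\<delta> \<alpha> b") (auto simp: letter_step_def)
  qed
  then show ?case
    by (cases \<xi>) (simp_all add: letter_step_def)
qed auto

lemma total_action_trace_of:
  assumes "partial_action I \<delta>" "sym I" "irrefl I"
  shows "total_action \<delta> \<xi> (trace_of I u) = foldl (letter_step \<delta>) \<xi> u"
  unfolding total_action_def
  by (rule foldl_letter_step_cong[OF assms trace_eq_some, symmetric])

lemma total_action_right_action:
  assumes "partial_action I \<delta>" "sym I" "irrefl I"
  shows "total_action \<delta> \<xi> \<one>\<^bsub>trace_monoid I\<^esub> = \<xi>"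
    and "x \<in> carrier (trace_monoid I) \<Longrightarrow> y \<in> carrier (trace_monoid I) \<Longrightarrow>
      total_action \<delta> \<xi> (x \<otimes>\<^bsub>trace_monoid I\<^esub> y) = total_action \<delta> (total_action \<delta> \<xi> x) y"
    and "total_action \<delta> (Some \<alpha>) (trace_of I [a]) = \<delta> \<alpha> a"
    and "total_action \<delta> None (trace_of I [a]) = None"
proof -
  show "total_action \<delta> \<xi> \<one>\<^bsub>trace_monoid I\<^esub> = \<xi>"
    using total_action_trace_of[OF assms, of _ "[]"] by (simp add: trace_monoid_def)
  show "total_action \<delta> \<xi> (x \<otimes>\<^bsub>trace_monoid I\<^esub> y) = total_action \<delta> (total_action \<delta> \<xi> x) y"
    if xy: "x \<in> carrier (trace_monoid I)" "y \<in> carrier (trace_monoid I)"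
  proof -
    obtain u where "x = trace_of I u"
      using xy(1) by (auto simp: trace_monoid_def)
    moreover obtain v where "y = trace_of I v"
      using xy(2) by (auto simp: trace_monoid_def)
    ultimately show ?thesis
      by (simp add: trace_mult_trace_of total_action_trace_of[OF assms])
  qed
qed (simp_all add: total_action_trace_of[OF assms] letter_step_def)

lemma total_action_unique:
  assumes "partial_action I \<delta>" "sym I" "irrefl I"
    and one: "\<And>\<xi>. f \<xi> \<one>\<^bsub>trace_monoid I\<^esub> = \<xi>"
    and mult: "\<And>\<xi> x y. x \<in> carrier (trace_monoid I) \<Longrightarrow> y \<in> carrier (trace_monoid I) \<Longrightarrow>
      f \<xi> (x \<otimes>\<^bsub>trace_monoid I\<^esub> y) = f (f \<xi> x) y"
    and letter: "\<And>\<alpha> a. f (Some \<alpha>) (trace_of I [a]) = \<delta> \<alpha> a"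
    and bot: "\<And>a. f None (trace_of I [a]) = None"
    and "x \<in> carrier (trace_monoid I)"
  shows "f \<xi> x = total_action \<delta> \<xi> x"
proof -
  obtain u where u: "x = trace_of I u"
    using assms(8) by (auto simp: trace_monoid_def)
  have step: "f \<xi> (trace_of I [a]) = letter_step \<delta> \<xi> a" for \<xi> a
    by (cases \<xi>) (simp_all add: letter bot letter_step_def)
  have "f \<xi> (trace_of I u) = foldl (letter_step \<delta>) \<xi> u"
  proof (induction u arbitrary: \<xi>)
    case Nil
    then show ?case using one by (simp add: trace_monoid_def)
  next
    case (Cons a u)
    have "f \<xi> (trace_of I (a # u)) = f (f \<xi> (trace_of I [a])) (trace_of I u)"
      using mult[of "trace_of I [a]" "trace_of I u" \<xi>] trace_mult_trace_of[of I "[a]" u]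
      by (simp add: trace_monoid_def)
    then show ?case by (simp add: step Cons.IH)
  qed
  then show ?thesis by (simp add: u total_action_trace_of[OF assms(1-3)])
qed

end

theory Submission
  imports Defs "HOL-Complex_Analysis.Laurent_Convergence"
begin

text \<open>
  The cliques that left-divide a trace \<open>w\<close> correspond to the subsets of the set of letters that
  left-divide \<open>w\<close>, so their signed count vanishes unless \<open>w = 1\<close>. With \<open>G\<^sub>\<alpha>\<^sub>\<beta>(z)\<close> the generating
  series of \<open>M\<^sub>\<alpha>\<^sub>,\<^sub>\<beta>\<close> this gives \<open>\<mu>(z) G(z) = 1\<close> at every complex \<open>z\<close> where the series converge
  absolutely; hence \<open>\<theta>(z) \<noteq> 0\<close> there, in particular for \<open>\<bar>z\<bar> < t\<^sub>0\<close>.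

  Suppose \<open>\<theta>(t\<^sub>0) \<noteq> 0\<close>. By Cramer's rule \<open>Z\<^sub>\<alpha>\<close> is a quotient of a polynomial by \<open>\<theta>\<close>, so \<open>Z\<^sub>\<alpha>(r)\<close> stays
  bounded as \<open>r\<close> increases to \<open>t\<^sub>0\<close>, and since the coefficients are nonnegative the series converges
  at \<open>t\<^sub>0\<close>. Then \<open>G\<close> converges absolutely on the closed disk of radius \<open>t\<^sub>0\<close>, so \<open>\<theta>\<close> has no zero there nor,
  by compactness, in some larger disk. The quotient is holomorphic in that disk, which contradicts
  \<open>t\<^sub>0\<close> being the radius of convergence.
\<close>

no_notation fps_nth (infixl "$" 75)

subsection \<open>Cancellation and divisibility by cliques\<close>

lemma trace_eq_set: "trace_eq I u v \<Longrightarrow> set u = set v"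
  by (induction rule: trace_eq.induct) auto

text \<open>Equivalent words have the same letters, so in a concatenation the deletion hits the same
  factor on both sides. Repeated deletion gives left cancellation.\<close>

lemma trace_eq_remove1: "trace_eq I u v \<Longrightarrow> trace_eq I (remove1 a u) (remove1 a v)"
proof (induction rule: trace_eq.induct)
  case (trace_eq_append u u' v v')
  then show ?case
    using trace_eq_set[OF trace_eq_append.hyps(1)]
    by (auto simp: remove1_append intro: trace_eq.trace_eq_append)
qed (auto intro: trace_eq.intros)

lemma trace_eq_Cons: "trace_eq I u v \<Longrightarrow> trace_eq I (a # u) (a # v)"
  using trace_eq_append[OF trace_eq_refl[of I "[a]"], of u v] by simp

lemma trace_eq_cancel: "trace_eq I (w @ u) (w @ v) \<Longrightarrow> trace_eq I u v"
proof (induction w)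
  case (Cons a w)
  then show ?case using trace_eq_remove1[of I "a # w @ u" "a # w @ v" a] by simp
qed simp

text \<open>\<open>front I a u\<close> says that the letter \<open>a\<close> left-divides the trace of \<open>u\<close>.\<close>

fun front :: "('a \<times> 'a) set \<Rightarrow> 'a \<Rightarrow> 'a list \<Rightarrow> bool" where
  "front I a [] \<longleftrightarrow> False"
| "front I a (x # u) \<longleftrightarrow> x = a \<or> (x, a) \<in> I \<and> front I a u"

lemma front_append:
  "front I a (u @ v) \<longleftrightarrow> front I a u \<or> (\<forall>x\<in>set u. (x, a) \<in> I) \<and> front I a v"
  by (induction u) auto

lemma front_cong:
  assumes "sym I" "trace_eq I u v"
  shows "front I a u \<longleftrightarrow> front I a v"
  using assms(2)
proof (induction rule: trace_eq.induct)
  case (trace_eq_append u u' v v')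
  then show ?case
    using trace_eq_set[OF trace_eq_append.hyps(1)] by (auto simp: front_append)
next
  case (trace_eq_commute x y)
  then show ?case using assms(1) by (auto dest: symD)
qed auto

text \<open>Every letter before the first \<open>a\<close> commutes with \<open>a\<close>, so this
  \<open>a\<close> can be moved to the head of the word.\<close>

lemma front_remove1:
  assumes "front I a u"
  shows "trace_eq I u (a # remove1 a u)"
  using assms
proof (induction u)
  case (Cons x u)
  show ?case
  proof (cases "x = a")
    case False
    then have xa: "(x, a) \<in> I" and "front I a u" using Cons.prems by auto
    then have "trace_eq I (x # u) (x # a # remove1 a u)"
      using Cons.IH by (simp add: trace_eq_Cons)
    also have "trace_eq I (x # a # remove1 a u) (a # x # remove1 a u)"
      using trace_eq_append[OF trace_eq_commute[OF xa] trace_eq_refl[of I "remove1 a u"]] by simp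
    finally (trace_eq_trans) show ?thesis using False by simp
  qed (simp add: trace_eq_refl)
qed simp

text \<open>Whichever of \<open>a\<close> and \<open>b\<close> occurs first in \<open>u\<close> has
  to be passed by the other one.\<close>

lemma front_independent:
  assumes "sym I" "front I a u" "front I b u" "a \<noteq> b"
  shows "(a, b) \<in> I"
  using assms(2,3)
  by (induction u) (use assms(1,4) in \<open>auto dest: symD\<close>)

section \<open>Cliques as sets of pairwise independent letters\<close>

definition independent :: "('a \<times> 'a) set \<Rightarrow> 'a set \<Rightarrow> bool" where
  "independent I A \<longleftrightarrow> (\<forall>a\<in>A. \<forall>b\<in>A. a \<noteq> b \<longrightarrow> (a, b) \<in> I)"

lemma front_independent_word:
  assumes "independent I (set w)" "a \<in> set w"
  shows "front I a w"
proof -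
  obtain w1 w2 where w: "w = w1 @ a # w2" "a \<notin> set w1"
    using split_list_first[OF assms(2)] by blast
  then have "\<forall>x\<in>set w1. (x, a) \<in> I" using assms(1) by (auto simp: independent_def)
  then show ?thesis by (simp add: w(1) front_append)
qed

text \<open>For the converse direction the letters of \<open>w\<close> are split off one at a time:
  once \<open>a\<close> has been divided out, each remaining letter of \<open>w\<close> is still in
  front, since it differs from \<open>a\<close>.\<close>

lemma divides_iff_front:
  assumes "sym I" "distinct w" "independent I (set w)"
  shows "(\<exists>v. trace_eq I u (w @ v)) \<longleftrightarrow> (\<forall>a\<in>set w. front I a u)"
proof
  assume "\<exists>v. trace_eq I u (w @ v)"
  then show "\<forall>a\<in>set w. front I a u"
    using front_independent_word[OF assms(3)] by (auto simp: front_cong[OF assms(1)] front_append)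
next
  assume "\<forall>a\<in>set w. front I a u"
  with assms(2,3) show "\<exists>v. trace_eq I u (w @ v)"
  proof (induction w arbitrary: u)
    case Nil
    then show ?case by (auto intro: trace_eq_refl)
  next
    case (Cons a w)
    have u: "trace_eq I u (a # remove1 a u)"
      using Cons.prems(3) by (simp add: front_remove1)
    have "front I b (remove1 a u)" if "b \<in> set w" for b
    proof -
      have "front I b (a # remove1 a u)" "b \<noteq> a"
        using that Cons.prems front_cong[OF assms(1) u] by auto
      then show ?thesis by auto
    qed
    then obtain v where "trace_eq I (remove1 a u) (w @ v)"
      using Cons.IH[of "remove1 a u"] Cons.prems by (auto simp: independent_def)
    then show ?case using trace_eq_trans[OF u trace_eq_Cons] by auto
  qed
qed

text \<open>Each letter of \<open>w'\<close> is in front of \<open>w\<close>, so \<open>w'\<close>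
  divides \<open>w\<close>, and equal lengths leave an empty quotient. A clique is therefore
  determined by its set of letters.\<close>

lemma trace_eq_independent:
  assumes "sym I" "independent I (set w)" "distinct w" "distinct w'" "set w = set w'"
  shows "trace_eq I w w'"
proof -
  have "\<forall>a\<in>set w'. front I a w"
    using front_independent_word[OF assms(2)] assms(5) by auto
  then obtain v where v: "trace_eq I w (w' @ v)"
    using divides_iff_front[of I w' w] assms by auto
  moreover have "length w = length w'"
    using assms by (metis distinct_card)
  ultimately have "v = []" using trace_eq_length[OF v] by simp
  then show ?thesis using v by simp
qed

lemma carrier_trace_monoid: "carrier (trace_monoid I) = range (trace_of I)"
  by (simp add: trace_monoid_def)

definition divides :: "('a \<times> 'a) set \<Rightarrow> 'a list set \<Rightarrow> 'a list set \<Rightarrow> bool" where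
  "divides I x y \<longleftrightarrow> (\<exists>z\<in>carrier (trace_monoid I). y = x \<otimes>\<^bsub>trace_monoid I\<^esub> z)"

lemma divides_trace_of:
  "divides I (trace_of I w) (trace_of I u) \<longleftrightarrow> (\<exists>v. trace_eq I u (w @ v))"
  by (auto simp: divides_def carrier_trace_monoid trace_mult_trace_of trace_of_eq_iff)

lemma cliques_eq: "cliques I = {trace_of I w |w. distinct w \<and> independent I (set w)}"
  by (simp add: cliques_def independent_def)

lemma finite_cliques: "finite (cliques (I :: ('a::finite \<times> 'a) set))"
proof (rule finite_subset)
  show "cliques I \<subseteq> trace_of I ` {w. set w \<subseteq> UNIV \<and> length w \<le> CARD('a)}"
  proof
    fix \<gamma> assume "\<gamma> \<in> cliques I"
    then obtain w where w: "\<gamma> = trace_of I w" "distinct w" by (auto simp: cliques_eq)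
    moreover have "card (set w) \<le> CARD('a)" by (rule card_mono) auto
    ultimately show "\<gamma> \<in> trace_of I ` {w. set w \<subseteq> UNIV \<and> length w \<le> CARD('a)}"
      by (auto simp: distinct_card)
  qed
qed (intro finite_imageI finite_lists_length_le finite)

text \<open>This is the expansion of the product of the factors \<open>1 - 1\<close> over
  \<open>A\<close>.\<close>

lemma sum_Pow_minus_one:
  assumes "finite A"
  shows "(\<Sum>B\<in>Pow A. (- 1) ^ card B) = (if A = {} then 1 else (0 :: 'b::comm_ring_1))"
  using prod_diff_conv_sum[OF assms, of "\<lambda>_. 1 :: 'b" "\<lambda>_. 1"] assms
  by (simp add: card_eq_0_iff power_0_left)

text \<open>A dividing clique is sent to its set of letters. Every set of letters in front of
  \<open>u\<close> is reached, because letters in front of the same word are pairwise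
  independent.\<close>

lemma sum_cliques_dividing:
  fixes I :: "('a::finite \<times> 'a) set"
  assumes "sym I"
  shows "(\<Sum>\<gamma>\<in>{\<gamma>\<in>cliques I. divides I \<gamma> (trace_of I u)}. (- 1) ^ trace_length \<gamma>) =
      (if u = [] then 1 else (0 :: 'b::comm_ring_1))"
proof -
  define F where "F = {a. front I a u}"
  \<comment> \<open>All words of a trace use the same letters, so this union is the alphabet of the
    trace.\<close>
  have alph: "\<Union>(set ` trace_of I w) = set w" for w
    using trace_eq_set trace_eq_refl by (fastforce simp: trace_of_def)
  let ?C = "{\<gamma>\<in>cliques I. divides I \<gamma> (trace_of I u)}"
  have C: "?C = {trace_of I w |w. distinct w \<and> independent I (set w) \<and> set w \<subseteq> F}"
    using divides_iff_front[OF assms]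
    by (auto simp: cliques_eq divides_trace_of F_def subset_iff)
  have "bij_betw (\<lambda>\<gamma>. \<Union>(set ` \<gamma>)) ?C (Pow F)"
  proof (rule bij_betw_imageI)
    show "inj_on (\<lambda>\<gamma>. \<Union>(set ` \<gamma>)) ?C"
      unfolding C
      by (intro inj_onI)
         (clarsimp simp: alph trace_of_eq_iff, rule trace_eq_independent[OF assms], auto)
    show "(\<lambda>\<gamma>. \<Union>(set ` \<gamma>)) ` ?C = Pow F"
    proof (intro equalityI subsetI)
      fix A assume A: "A \<in> Pow F"
      obtain w where w: "set w = A" "distinct w"
        using finite_distinct_list[of A] by auto
      have "independent I A"
        using A by (auto simp: independent_def F_def intro: front_independent[OF assms])
      then have "trace_of I w \<in> ?C" unfolding C using w A by blast
      then show "A \<in> (\<lambda>\<gamma>. \<Union>(set ` \<gamma>)) ` ?C"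
        using alph[of w] w by (intro image_eqI[of _ _ "trace_of I w"]) auto
    next
      fix A assume "A \<in> (\<lambda>\<gamma>. \<Union>(set ` \<gamma>)) ` ?C"
      then obtain w where "A = \<Union>(set ` trace_of I w)" "set w \<subseteq> F" unfolding C by blast
      then show "A \<in> Pow F" by (simp only: alph Pow_iff)
    qed
  qed
  then have "(\<Sum>B\<in>Pow F. (- 1) ^ card B) =
      (\<Sum>\<gamma>\<in>?C. (- 1) ^ card (\<Union>(set ` \<gamma>)) :: 'b)"
    by (rule sum.reindex_bij_betw[symmetric])
  also have "\<dots> = (\<Sum>\<gamma>\<in>?C. (- 1) ^ trace_length \<gamma>)"
    by (intro sum.cong) (auto simp: C alph trace_length_trace_of distinct_card)
  finally have "(\<Sum>\<gamma>\<in>?C. (- 1) ^ trace_length \<gamma>) = (if F = {} then 1 else (0 :: 'b))"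
    by (simp add: sum_Pow_minus_one)
  \<comment> \<open>The first letter of a nonempty word is always in front.\<close>
  moreover have "F = {} \<longleftrightarrow> u = []"
    by (cases u) (auto simp: F_def)
  ultimately show ?thesis by simp
qed

subsection \<open>Moebius inversion\<close>

lemma finite_traces_of_length:
  fixes I :: "('a::finite \<times> 'a) set"
  shows "finite {x \<in> carrier (trace_monoid I). trace_length x = n}"
    and "card {x \<in> carrier (trace_monoid I). trace_length x = n} \<le> CARD('a) ^ n"
proof -
  let ?L = "{w :: 'a list. set w \<subseteq> UNIV \<and> length w = n}"
  have eq: "{x \<in> carrier (trace_monoid I). trace_length x = n} = trace_of I ` ?L"
    by (auto simp: carrier_trace_monoid trace_length_trace_of)
  have L: "finite ?L" "card ?L = CARD('a) ^ n"
    by (intro finite_lists_length_eq card_lists_length_eq finite)+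
  show "finite {x \<in> carrier (trace_monoid I). trace_length x = n}"
    unfolding eq using L by (intro finite_imageI)
  show "card {x \<in> carrier (trace_monoid I). trace_length x = n} \<le> CARD('a) ^ n"
    unfolding eq using card_image_le[OF L(1), of "trace_of I"] L(2) by simp
qed

lemma trace_mult_closed:
  "x \<in> carrier (trace_monoid I) \<Longrightarrow> y \<in> carrier (trace_monoid I) \<Longrightarrow>
    x \<otimes>\<^bsub>trace_monoid I\<^esub> y \<in> carrier (trace_monoid I)"
  by (rule monoid.m_closed[OF trace_monoid_is_monoid])

lemma trace_length_mult:
  "x \<in> carrier (trace_monoid I) \<Longrightarrow> y \<in> carrier (trace_monoid I) \<Longrightarrow>
    trace_length (x \<otimes>\<^bsub>trace_monoid I\<^esub> y) = trace_length x + trace_length y"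
  by (auto simp: carrier_trace_monoid trace_mult_trace_of trace_length_trace_of)

lemma inj_on_trace_mult:
  assumes "x \<in> carrier (trace_monoid I)"
  shows "inj_on (\<lambda>y. x \<otimes>\<^bsub>trace_monoid I\<^esub> y) (carrier (trace_monoid I))"
proof (rule inj_onI)
  fix y z
  assume "y \<in> carrier (trace_monoid I)" "z \<in> carrier (trace_monoid I)"
    and eq: "x \<otimes>\<^bsub>trace_monoid I\<^esub> y = x \<otimes>\<^bsub>trace_monoid I\<^esub> z"
  with assms obtain w u v where "x = trace_of I w" "y = trace_of I u" "z = trace_of I v"
    by (auto simp: carrier_trace_monoid)
  with eq show "y = z"
    by (simp add: trace_mult_trace_of trace_of_eq_iff trace_eq_cancel)
qed

lemma cliques_subset_carrier: "cliques I \<subseteq> carrier (trace_monoid I)"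
  by (auto simp: cliques_def carrier_trace_monoid)

text \<open>The coefficient of degree \<open>n\<close> in the series
  \<open>G\<^sub>\<alpha>\<^sub>\<beta>\<close>.\<close>

definition path_count :: "('a \<times> 'a) set \<Rightarrow> ('x \<Rightarrow> 'a \<rightharpoonup> 'x) \<Rightarrow> 'x \<Rightarrow> 'x \<Rightarrow> nat \<Rightarrow> nat" where
  "path_count I \<delta> \<alpha> \<beta> n = card {x \<in> traces_between I \<delta> \<alpha> \<beta>. trace_length x = n}"

lemma finite_traces_between:
  fixes I :: "('a::finite \<times> 'a) set"
  shows "finite {x \<in> traces_between I \<delta> \<alpha> \<beta>. trace_length x = n}"
  by (rule finite_subset[OF _ finite_traces_of_length(1)[of I n]]) (auto simp: traces_between_def)

lemma finite_traces_from:
  fixes I :: "('a::finite \<times> 'a) set"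
  shows "finite {x \<in> traces_from I \<delta> \<alpha>. trace_length x = n}"
  by (rule finite_subset[OF _ finite_traces_of_length(1)[of I n]]) (auto simp: traces_from_def)

lemma growth_series_nth:
  fixes I :: "('a::finite \<times> 'a) set" and \<delta> :: "'x::finite \<Rightarrow> 'a \<rightharpoonup> 'x"
  shows "fps_nth (growth_series I \<delta> \<alpha>) n = (\<Sum>\<beta>\<in>UNIV. real (path_count I \<delta> \<alpha> \<beta> n))"
proof -
  have "{x \<in> traces_from I \<delta> \<alpha>. trace_length x = n} =
      (\<Union>\<beta>\<in>UNIV. {x \<in> traces_between I \<delta> \<alpha> \<beta>. trace_length x = n})"
    by (auto simp: traces_from_def traces_between_def)
  also have "card \<dots> = (\<Sum>\<beta>\<in>UNIV. path_count I \<delta> \<alpha> \<beta> n)"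
    unfolding path_count_def
    by (intro card_UN_disjoint finite ballI impI finite_traces_between)
       (auto simp: traces_between_def)
  finally show ?thesis by (simp add: growth_series_def)
qed

lemma coeff_mu_matrix:
  fixes \<delta> :: "'x::finite \<Rightarrow> 'a \<rightharpoonup> 'x"
  shows "coeff (mu_matrix I \<delta> $ \<alpha> $ \<beta>) k =
    (\<Sum>\<gamma>\<in>cliques I \<inter> traces_between I \<delta> \<alpha> \<beta>. if trace_length \<gamma> = k then (- 1) ^ trace_length \<gamma> else 0)"
  by (simp add: mu_matrix_def coeff_sum)

locale trace_action =
  fixes I :: "('a::finite \<times> 'a) set" and \<delta> :: "'x::finite \<Rightarrow> 'a \<rightharpoonup> 'x"
  assumes irrefl: "irrefl I" and sym: "sym I" and partial_action: "partial_action I \<delta>"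
begin

lemmas total_action_mult = total_action_right_action(2)[OF partial_action sym irrefl]
lemmas total_action_word = total_action_trace_of[OF partial_action sym irrefl]

lemma foldl_letter_step_None: "foldl (letter_step \<delta>) None u = None"
  by (induction u) (simp_all add: letter_step_def)

lemma total_action_None: "x \<in> carrier (trace_monoid I) \<Longrightarrow> total_action \<delta> None x = None"
  by (auto simp: carrier_trace_monoid total_action_word foldl_letter_step_None)

text \<open>By left cancellation, the multiples of \<open>\<gamma>\<close> leading from
  \<open>\<alpha>\<close> to \<open>\<kappa>\<close> correspond to their quotients, which lead to
  \<open>\<kappa>\<close> from the image of \<open>\<alpha>\<close> under \<open>\<gamma>\<close>.
  The double sum has at most one nonzero term; this form matches the coefficients of
  \<open>mu_matrix\<close> in the convolution below.\<close>

lemma card_divisible: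
  assumes \<gamma>: "\<gamma> \<in> carrier (trace_monoid I)"
  shows "card {w \<in> {x \<in> traces_between I \<delta> \<alpha> \<kappa>. trace_length x = n}. divides I \<gamma> w} =
    (\<Sum>k\<le>n. \<Sum>\<beta>\<in>UNIV. if \<gamma> \<in> traces_between I \<delta> \<alpha> \<beta> \<and> trace_length \<gamma> = k
       then path_count I \<delta> \<beta> \<kappa> (n - k) else 0)" (is "card ?D = _")
proof -
  have D: "w \<in> ?D \<longleftrightarrow> (\<exists>y\<in>carrier (trace_monoid I). w = \<gamma> \<otimes>\<^bsub>trace_monoid I\<^esub> y \<and>
      total_action \<delta> (total_action \<delta> (Some \<alpha>) \<gamma>) y = Some \<kappa> \<and> trace_length \<gamma> + trace_length y = n)" for w
    using \<gamma> by (auto simp: divides_def traces_between_def total_action_mult trace_length_mult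
        trace_mult_closed)
  show ?thesis
  proof (cases "total_action \<delta> (Some \<alpha>) \<gamma>")
    case None
    then have "?D = {}" using D by (auto simp: total_action_None)
    then have "card ?D = 0" by (simp only: card.empty)
    moreover have "\<gamma> \<notin> traces_between I \<delta> \<alpha> \<beta>" for \<beta>
      using None by (simp add: traces_between_def)
    ultimately show ?thesis by simp
  next
    case (Some \<beta>)
    then have iff: "\<gamma> \<in> traces_between I \<delta> \<alpha> \<beta>' \<longleftrightarrow> \<beta>' = \<beta>" for \<beta>'
      using \<gamma> by (auto simp: traces_between_def)
    have inner: "(\<Sum>\<beta>'\<in>UNIV. if \<gamma> \<in> traces_between I \<delta> \<alpha> \<beta>' \<and> trace_length \<gamma> = k
       then path_count I \<delta> \<beta>' \<kappa> (n - k) else 0) =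
       (if k = trace_length \<gamma> then path_count I \<delta> \<beta> \<kappa> (n - k) else 0)" for k
      by (auto simp: iff)
    show ?thesis
    proof (cases "trace_length \<gamma> \<le> n")
      case True
      have "?D = (\<lambda>y. \<gamma> \<otimes>\<^bsub>trace_monoid I\<^esub> y) `
          {y \<in> traces_between I \<delta> \<beta> \<kappa>. trace_length y = n - trace_length \<gamma>}"
      proof (rule Set.set_eqI)
        fix w
        show "w \<in> ?D \<longleftrightarrow> w \<in> (\<lambda>y. \<gamma> \<otimes>\<^bsub>trace_monoid I\<^esub> y) `
          {y \<in> traces_between I \<delta> \<beta> \<kappa>. trace_length y = n - trace_length \<gamma>}"
          unfolding D using True Some by (auto simp: traces_between_def)
      qed
      also have "card \<dots> = path_count I \<delta> \<beta> \<kappa> (n - trace_length \<gamma>)"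
        unfolding path_count_def
        by (rule card_image, rule inj_on_subset[OF inj_on_trace_mult[OF \<gamma>]])
           (auto simp: traces_between_def)
      finally show ?thesis using True by (simp add: inner)
    next
      case False
      then have "?D = {}" using D by auto
      then have "card ?D = 0" by (simp only: card.empty)
      then show ?thesis using False by (simp add: inner)
    qed
  qed
qed

text \<open>The coefficient of degree \<open>n\<close> in the identity
  \<open>\<mu>(z) G(z) = 1\<close>. The pairs of a clique and a trace divisible by it are counted
  with sign, first grouped by the clique and then by the trace.\<close>

lemma moebius_convolution:
  "(\<Sum>k\<le>n. \<Sum>\<beta>\<in>UNIV. coeff (mu_matrix I \<delta> $ \<alpha> $ \<beta>) k * int (path_count I \<delta> \<beta> \<kappa> (n - k))) =
    (if n = 0 \<and> \<alpha> = \<kappa> then 1 else 0)"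
proof -
  define W where "W = {x \<in> traces_between I \<delta> \<alpha> \<kappa>. trace_length x = n}"
  have W: "finite W" unfolding W_def by (rule finite_traces_between)
  let ?s = "\<lambda>\<gamma>. (- 1) ^ trace_length \<gamma> :: int"
  have "(\<Sum>k\<le>n. \<Sum>\<beta>\<in>UNIV. coeff (mu_matrix I \<delta> $ \<alpha> $ \<beta>) k * int (path_count I \<delta> \<beta> \<kappa> (n - k))) =
    (\<Sum>k\<le>n. \<Sum>\<beta>\<in>UNIV. \<Sum>\<gamma>\<in>cliques I. ?s \<gamma> * int (if \<gamma> \<in> traces_between I \<delta> \<alpha> \<beta> \<and> trace_length \<gamma> = k
       then path_count I \<delta> \<beta> \<kappa> (n - k) else 0))"
  proof (intro sum.cong refl)
    fix k \<beta>
    have "coeff (mu_matrix I \<delta> $ \<alpha> $ \<beta>) k = (\<Sum>\<gamma>\<in>cliques I.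
        if \<gamma> \<in> traces_between I \<delta> \<alpha> \<beta> then if trace_length \<gamma> = k then ?s \<gamma> else 0 else 0)"
      unfolding coeff_mu_matrix by (rule sum.inter_restrict[OF finite_cliques])
    then show "coeff (mu_matrix I \<delta> $ \<alpha> $ \<beta>) k * int (path_count I \<delta> \<beta> \<kappa> (n - k)) =
      (\<Sum>\<gamma>\<in>cliques I. ?s \<gamma> * int (if \<gamma> \<in> traces_between I \<delta> \<alpha> \<beta> \<and> trace_length \<gamma> = k
       then path_count I \<delta> \<beta> \<kappa> (n - k) else 0))"
      by (simp only: sum_distrib_right) (intro sum.cong, auto)
  qed
  also have "\<dots> = (\<Sum>k\<le>n. \<Sum>\<gamma>\<in>cliques I. \<Sum>\<beta>\<in>UNIV. ?s \<gamma> * int (if \<gamma> \<in> traces_between I \<delta> \<alpha> \<beta> \<and> trace_length \<gamma> = k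
       then path_count I \<delta> \<beta> \<kappa> (n - k) else 0))"
    by (intro sum.cong refl, rule sum.swap)
  also have "\<dots> = (\<Sum>\<gamma>\<in>cliques I. \<Sum>k\<le>n. \<Sum>\<beta>\<in>UNIV. ?s \<gamma> * int (if \<gamma> \<in> traces_between I \<delta> \<alpha> \<beta> \<and> trace_length \<gamma> = k
       then path_count I \<delta> \<beta> \<kappa> (n - k) else 0))"
    by (rule sum.swap)
  \<comment> \<open>For a fixed clique the sums over \<open>k\<close> and \<open>\<beta>\<close>
    count the traces in \<open>W\<close> that it divides.\<close>
  also have "\<dots> = (\<Sum>\<gamma>\<in>cliques I. ?s \<gamma> * int (card {w\<in>W. divides I \<gamma> w}))"
    unfolding W_def using cliques_subset_carrier
    by (intro sum.cong refl, subst card_divisible) (auto simp: sum_distrib_left)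
  also have "\<dots> = (\<Sum>\<gamma>\<in>cliques I. \<Sum>w\<in>W. if divides I \<gamma> w then ?s \<gamma> else 0)"
    using W by (simp add: sum.If_cases Int_def mult.commute)
  \<comment> \<open>Grouped by \<open>w\<close>, the inner sum is the signed count of the cliques
    dividing \<open>w\<close>, which only the empty trace survives.\<close>
  also have "\<dots> = (\<Sum>w\<in>W. \<Sum>\<gamma>\<in>cliques I. if divides I \<gamma> w then ?s \<gamma> else 0)"
    by (rule sum.swap)
  also have "\<dots> = (\<Sum>w\<in>W. if w = trace_of I [] then 1 else 0)"
  proof (intro sum.cong refl)
    fix w assume "w \<in> W"
    then obtain u where u: "w = trace_of I u"
      by (auto simp: W_def traces_between_def carrier_trace_monoid)
    then have "w = trace_of I [] \<longleftrightarrow> u = []"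
      using trace_eq_length[of I u "[]"] by (auto simp: trace_of_eq_iff trace_eq_refl)
    then show "(\<Sum>\<gamma>\<in>cliques I. if divides I \<gamma> w then ?s \<gamma> else 0) = (if w = trace_of I [] then 1 else 0)"
      using sum_cliques_dividing[OF sym, of u, where 'b=int] u
      by (simp add: sum.inter_filter[OF finite_cliques])
  qed
  also have "\<dots> = (if trace_of I [] \<in> W then 1 else 0)"
    using W by simp
  \<comment> \<open>The empty trace has length 0 and fixes \<open>\<alpha>\<close>.\<close>
  also have "trace_of I [] \<in> W \<longleftrightarrow> n = 0 \<and> \<alpha> = \<kappa>"
    by (auto simp: W_def traces_between_def carrier_trace_monoid total_action_word trace_length_trace_of)
  finally show ?thesis .
qed

end

subsection \<open>Generating series\<close>

lemma poly_of_int_hom: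
  fixes z :: "'b::comm_ring_1"
  shows "poly (map_poly of_int (p + q)) z = poly (map_poly of_int p) z + poly (map_poly of_int q) z"
    and "poly (map_poly of_int (p * q)) z = poly (map_poly of_int p) z * poly (map_poly of_int q) z"
proof -
  have add: "map_poly of_int (p + q) = (map_poly of_int p + map_poly of_int q :: 'b poly)" for p q
    by (intro poly_eqI) (simp add: coeff_map_poly)
  have smult: "map_poly of_int (smult c p) = (smult (of_int c) (map_poly of_int p) :: 'b poly)" for c p
    by (intro poly_eqI) (simp add: coeff_map_poly)
  show "poly (map_poly of_int (p + q)) z = poly (map_poly of_int p) z + poly (map_poly of_int q) z"
    by (simp add: add)
  show "poly (map_poly of_int (p * q)) z = poly (map_poly of_int p) z * poly (map_poly of_int q) z"
    by (induction p) (simp_all add: add smult map_poly_pCons algebra_simps)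
qed

text \<open>Serves the signs of the permutations, which occur in \<open>det\<close> as
  \<open>of_int\<close> constants.\<close>

lemma poly_of_int_of_int [simp]: "poly (map_poly of_int (of_int c)) z = (of_int c :: 'b::comm_ring_1)"
  by (simp add: of_int_poly map_poly_pCons)

lemma poly_of_int_sum:
  "poly (map_poly of_int (\<Sum>i\<in>A. f i)) z = (\<Sum>i\<in>A. poly (map_poly of_int (f i)) (z :: 'b::comm_ring_1))"
  by (induction A rule: infinite_finite_induct) (simp_all add: poly_of_int_hom)

lemma poly_of_int_prod:
  "poly (map_poly of_int (\<Prod>i\<in>A. f i)) z = (\<Prod>i\<in>A. poly (map_poly of_int (f i)) (z :: 'b::comm_ring_1))"
proof (induction A rule: infinite_finite_induct)
  case (infinite A)
  then show ?case by (simp add: map_poly_1)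
next
  case empty
  then show ?case by (simp add: map_poly_1)
qed (simp add: poly_of_int_hom)

text \<open>The determinant is a polynomial expression in the entries, so it commutes with the ring
  homomorphism of evaluation.\<close>

lemma poly_of_int_det:
  fixes A :: "int poly ^ 'n ^ 'n" and z :: "'b::comm_ring_1"
  shows "poly (map_poly of_int (det A)) z = det (\<chi> i j. poly (map_poly of_int (A $ i $ j)) z)"
  by (simp add: det_def poly_of_int_sum poly_of_int_hom poly_of_int_prod)

lemma poly_of_int_of_real:
  "poly (map_poly of_int p) (of_real t :: complex) = of_real (poly (map_poly of_int p) t)"
  by (induction p) (simp_all add: map_poly_pCons)

lemma holomorphic_on_det:
  assumes "\<And>i j. (\<lambda>z. A z $ i $ j) holomorphic_on S"
  shows "(\<lambda>z. det (A z)) holomorphic_on S"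
  unfolding det_def by (intro holomorphic_intros assms)

lemma sums_poly:
  fixes z :: "'b::real_normed_field"
  shows "(\<lambda>n. coeff p n * z ^ n) sums poly p z"
proof -
  have "(\<lambda>n. coeff p n * z ^ n) sums (\<Sum>n\<in>{..degree p}. coeff p n * z ^ n)"
    by (rule sums_finite) (auto simp: coeff_eq_0)
  then show ?thesis by (simp add: poly_altdef)
qed

definition mu_eval :: "('a \<times> 'a) set \<Rightarrow> ('x::finite \<Rightarrow> 'a \<rightharpoonup> 'x) \<Rightarrow> complex \<Rightarrow> complex ^ 'x ^ 'x" where
  "mu_eval I \<delta> z = (\<chi> \<alpha> \<beta>. poly (map_poly of_int (mu_matrix I \<delta> $ \<alpha> $ \<beta>)) z)"

text \<open>This is \<open>G(z)\<close> only where the entry series converge; elsewhere the infinite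
  sums carry no meaning.\<close>

definition path_eval :: "('a \<times> 'a) set \<Rightarrow> ('x::finite \<Rightarrow> 'a \<rightharpoonup> 'x) \<Rightarrow> complex \<Rightarrow> complex ^ 'x ^ 'x" where
  "path_eval I \<delta> z = (\<chi> \<alpha> \<beta>. \<Sum>n. of_nat (path_count I \<delta> \<alpha> \<beta> n) * z ^ n)"

lemma theta_eval: "poly (map_poly of_int (theta I \<delta>)) z = det (mu_eval I \<delta> z)"
  by (simp add: theta_def poly_of_int_det mu_eval_def)

lemma growth_series_nonneg: "fps_nth (growth_series I \<delta> \<alpha>) n \<ge> 0"
  by (simp add: growth_series_def)

section \<open>Inversion of the matrix of clique polynomials where the series converge\<close>

context trace_action
begin

text \<open>Each entry of the product is a sum of Cauchy products of a polynomial with an absolutely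
  convergent series. By \<open>moebius_convolution\<close> only the term of degree 0 can
  survive.\<close>

lemma mu_eval_path_eval:
  assumes sm: "\<And>\<alpha> \<beta>. summable (\<lambda>n. norm (of_nat (path_count I \<delta> \<alpha> \<beta> n) * z ^ n))"
  shows "mu_eval I \<delta> z ** path_eval I \<delta> z = mat 1"
proof (simp only: vec_eq_iff, intro allI)
  fix \<alpha> \<kappa>
  let ?p = "\<lambda>\<beta>. map_poly of_int (mu_matrix I \<delta> $ \<alpha> $ \<beta>) :: complex poly"
  let ?a = "\<lambda>\<beta> n. coeff (?p \<beta>) n * z ^ n"
  let ?b = "\<lambda>\<beta> n. of_nat (path_count I \<delta> \<beta> \<kappa> n) * z ^ n"
  have a: "summable (\<lambda>n. norm (?a \<beta> n))" for \<beta>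
    by (rule summable_finite[of "{..degree (?p \<beta>)}"]) (auto simp: coeff_eq_0)
  have "(\<lambda>n. \<Sum>i\<le>n. ?a \<beta> i * ?b \<beta> (n - i)) sums (poly (?p \<beta>) z * (\<Sum>n. ?b \<beta> n))" for \<beta>
    using Cauchy_product_sums[OF a sm] sums_unique[OF sums_poly, of "?p \<beta>" z] by simp
  then have "(\<lambda>n. \<Sum>\<beta>\<in>UNIV. \<Sum>i\<le>n. ?a \<beta> i * ?b \<beta> (n - i)) sums
      (\<Sum>\<beta>\<in>UNIV. poly (?p \<beta>) z * (\<Sum>n. ?b \<beta> n))"
    by (intro sums_sum)
  moreover have "(\<Sum>\<beta>\<in>UNIV. \<Sum>i\<le>n. ?a \<beta> i * ?b \<beta> (n - i)) =
      (if n = 0 then if \<alpha> = \<kappa> then 1 else 0 else 0)" for n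
  proof -
    have "(\<Sum>\<beta>\<in>UNIV. \<Sum>i\<le>n. ?a \<beta> i * ?b \<beta> (n - i)) =
      (\<Sum>i\<le>n. \<Sum>\<beta>\<in>UNIV. ?a \<beta> i * ?b \<beta> (n - i))"
      by (rule sum.swap)
    also have "\<dots> = (\<Sum>i\<le>n. \<Sum>\<beta>\<in>UNIV.
       of_int (coeff (mu_matrix I \<delta> $ \<alpha> $ \<beta>) i * int (path_count I \<delta> \<beta> \<kappa> (n - i))) * z ^ n)"
    proof (intro sum.cong refl)
      fix i \<beta> assume "i \<in> {..n}"
      then have "z ^ n = z ^ i * z ^ (n - i)" by (simp flip: power_add)
      then show "?a \<beta> i * ?b \<beta> (n - i) =
        of_int (coeff (mu_matrix I \<delta> $ \<alpha> $ \<beta>) i * int (path_count I \<delta> \<beta> \<kappa> (n - i))) * z ^ n"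
        by (simp add: coeff_map_poly)
    qed
    also have "\<dots> = of_int (\<Sum>i\<le>n. \<Sum>\<beta>\<in>UNIV.
       coeff (mu_matrix I \<delta> $ \<alpha> $ \<beta>) i * int (path_count I \<delta> \<beta> \<kappa> (n - i))) * z ^ n"
      by (simp only: of_int_sum sum_distrib_right)
    also have "\<dots> = (if n = 0 then if \<alpha> = \<kappa> then 1 else 0 else 0)"
      unfolding moebius_convolution by auto
    finally show ?thesis .
  qed
  ultimately have "(\<lambda>n. if n = 0 then if \<alpha> = \<kappa> then 1 else 0 else 0) sums
      (\<Sum>\<beta>\<in>UNIV. poly (?p \<beta>) z * (\<Sum>n. ?b \<beta> n))"
    by simp
  from sums_unique2[OF this sums_single[of 0 "\<lambda>_. if \<alpha> = \<kappa> then 1 else 0"]]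
  show "(mu_eval I \<delta> z ** path_eval I \<delta> z) $ \<alpha> $ \<kappa> = mat 1 $ \<alpha> $ \<kappa>"
    by (simp add: matrix_matrix_mult_def mu_eval_def path_eval_def mat_def)
qed

lemma path_count_le_growth: "real (path_count I \<delta> \<alpha> \<beta> n) \<le> fps_nth (growth_series I \<delta> \<alpha>) n"
  unfolding growth_series_nth by (rule member_le_sum) auto

text \<open>The growth series dominates each of its path counts. Convergence is assumed at one
  radius \<open>r\<close> and used on the closed disk, so that \<open>r\<close> may later be the
  radius of convergence itself.\<close>

lemma summable_path_count:
  assumes "\<And>\<alpha>. summable (\<lambda>n. fps_nth (growth_series I \<delta> \<alpha>) n * r ^ n)" "norm z \<le> r"
  shows "summable (\<lambda>n. norm (of_nat (path_count I \<delta> \<alpha> \<beta> n) * z ^ n :: complex))"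
proof (rule summable_comparison_test'[OF assms(1)[of \<alpha>]])
  fix n
  show "norm (norm (of_nat (path_count I \<delta> \<alpha> \<beta> n) * z ^ n)) \<le> fps_nth (growth_series I \<delta> \<alpha>) n * r ^ n"
    using path_count_le_growth[of \<alpha> \<beta> n] assms(2)
    by (auto simp: norm_mult norm_power growth_series_nonneg intro!: mult_mono power_mono)
qed

text \<open>An invertible matrix has an invertible determinant.\<close>

lemma theta_nonzero:
  assumes "\<And>\<alpha>. summable (\<lambda>n. fps_nth (growth_series I \<delta> \<alpha>) n * r ^ n)" "norm z \<le> r"
  shows "det (mu_eval I \<delta> z) \<noteq> 0"
proof -
  have "det (mu_eval I \<delta> z) * det (path_eval I \<delta> z) = 1"
    using mu_eval_path_eval[OF summable_path_count[OF assms]] by (metis det_I det_mul)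
  then show ?thesis by auto
qed

text \<open>The numerator for the unknown \<open>\<alpha>\<close> in Cramer's rule, for the system
  with matrix \<open>mu_eval I \<delta> z\<close> and the all-ones vector on the right.\<close>

definition cramer_numerator :: "'x \<Rightarrow> complex \<Rightarrow> complex" where
  "cramer_numerator \<alpha> z = det (\<chi> i j. if j = \<alpha> then 1 else mu_eval I \<delta> z $ i $ j)"

lemma holomorphic_mu_eval: "(\<lambda>z. mu_eval I \<delta> z $ i $ j) holomorphic_on S"
  by (simp add: mu_eval_def) (intro holomorphic_intros)

lemma holomorphic_cramer_numerator: "cramer_numerator \<alpha> holomorphic_on S"
proof -
  have "(\<lambda>z. det (\<chi> i j. if j = \<alpha> then 1 else mu_eval I \<delta> z $ i $ j)) holomorphic_on S"
  proof (rule holomorphic_on_det)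
    fix i j
    show "(\<lambda>z. (\<chi> i j. if j = \<alpha> then 1 else mu_eval I \<delta> z $ i $ j) $ i $ j) holomorphic_on S"
      using holomorphic_mu_eval by (cases "j = \<alpha>") simp_all
  qed
  then show ?thesis by (simp add: cramer_numerator_def[abs_def])
qed

text \<open>The values of the growth series are the row sums of
  \<open>path_eval I \<delta> z\<close>. As the image of the all-ones vector under the inverse of
  \<open>mu_eval I \<delta> z\<close>, they solve the system of Cramer's rule.\<close>

lemma growth_series_sums:
  assumes "\<And>\<alpha>. summable (\<lambda>n. fps_nth (growth_series I \<delta> \<alpha>) n * r ^ n)" "norm z \<le> r"
  shows "(\<lambda>n. of_real (fps_nth (growth_series I \<delta> \<alpha>) n) * z ^ n) sums
    (cramer_numerator \<alpha> z / det (mu_eval I \<delta> z))"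
proof -
  note sm = summable_path_count[OF assms]
  let ?v = "path_eval I \<delta> z *v (\<chi> i. 1)"
  have "mu_eval I \<delta> z *v ?v = (\<chi> i. 1)"
    by (simp add: matrix_vector_mul_assoc mu_eval_path_eval[OF sm])
  then have v: "?v = (\<chi> k. det (\<chi> i j. if j = k then (\<chi> i. 1) $ i else mu_eval I \<delta> z $ i $ j)
      / det (mu_eval I \<delta> z))"
    by (simp only: cramer[OF theta_nonzero[OF assms]])
  have "?v $ \<alpha> = cramer_numerator \<alpha> z / det (mu_eval I \<delta> z)"
    unfolding v by (simp add: cramer_numerator_def cong: if_cong)
  moreover have "(\<lambda>n. \<Sum>\<beta>\<in>UNIV. of_nat (path_count I \<delta> \<alpha> \<beta> n) * z ^ n) sums
      (\<Sum>\<beta>\<in>UNIV. \<Sum>n. of_nat (path_count I \<delta> \<alpha> \<beta> n) * z ^ n)"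
    by (intro sums_sum summable_sums summable_norm_cancel[OF sm])
  ultimately show ?thesis
    by (simp add: growth_series_nth matrix_vector_mult_def path_eval_def sum_distrib_right)
qed

section \<open>Growth of the coefficients and the common radius of convergence\<close>

lemma exists_word: "\<exists>u. length u = n \<and> foldl (letter_step \<delta>) (Some \<alpha>) u \<noteq> None"
proof (induction n arbitrary: \<alpha>)
  case (Suc n)
  obtain a \<beta> where "\<delta> \<alpha> a = Some \<beta>"
    using partial_action unfolding partial_action_def by (metis dom_eq_empty_conv ext option.exhaust)
  then have "letter_step \<delta> (Some \<alpha>) a = Some \<beta>" by (simp add: letter_step_def)
  moreover obtain u where "length u = n" "foldl (letter_step \<delta>) (Some \<beta>) u \<noteq> None"
    using Suc by blast
  ultimately show ?case by (intro exI[of _ "a # u"]) simp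
qed simp

text \<open>Some letter is enabled at every point, so words of every length can be read from
  \<open>\<alpha>\<close>. This keeps the radius of convergence at most 1.\<close>

lemma growth_series_ge_1: "fps_nth (growth_series I \<delta> \<alpha>) n \<ge> 1"
proof -
  obtain u where "length u = n" "foldl (letter_step \<delta>) (Some \<alpha>) u \<noteq> None"
    using exists_word by blast
  then have "trace_of I u \<in> {x \<in> traces_from I \<delta> \<alpha>. trace_length x = n}"
    by (simp add: traces_from_def carrier_trace_monoid total_action_word trace_length_trace_of)
  then have "card {x \<in> traces_from I \<delta> \<alpha>. trace_length x = n} > 0"
    using finite_traces_from by (intro card_gt_0_iff[THEN iffD2]) auto
  then show ?thesis by (simp add: growth_series_def)
qed

lemma growth_series_le: "fps_nth (growth_series I \<delta> \<alpha>) n \<le> real CARD('a) ^ n"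
proof -
  have "card {x \<in> traces_from I \<delta> \<alpha>. trace_length x = n} \<le>
      card {x \<in> carrier (trace_monoid I). trace_length x = n}"
    by (intro card_mono finite_traces_of_length) (auto simp: traces_from_def)
  also have "\<dots> \<le> CARD('a) ^ n" by (rule finite_traces_of_length)
  finally show ?thesis by (simp add: growth_series_def flip: of_nat_power)
qed

text \<open>Left multiplication by \<open>x\<close> is injective and raises the length by a
  constant.\<close>

lemma growth_series_shift:
  assumes "x \<in> traces_between I \<delta> \<alpha> \<beta>"
  shows "fps_nth (growth_series I \<delta> \<beta>) n \<le> fps_nth (growth_series I \<delta> \<alpha>) (n + trace_length x)"
proof -
  have x: "x \<in> carrier (trace_monoid I)" "total_action \<delta> (Some \<alpha>) x = Some \<beta>"
    using assms by (auto simp: traces_between_def)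
  have "card {y \<in> traces_from I \<delta> \<beta>. trace_length y = n} \<le>
      card {y \<in> traces_from I \<delta> \<alpha>. trace_length y = n + trace_length x}"
  proof (rule card_inj_on_le)
    show "inj_on (\<lambda>y. x \<otimes>\<^bsub>trace_monoid I\<^esub> y) {y \<in> traces_from I \<delta> \<beta>. trace_length y = n}"
      by (rule inj_on_subset[OF inj_on_trace_mult[OF x(1)]]) (auto simp: traces_from_def)
    show "(\<lambda>y. x \<otimes>\<^bsub>trace_monoid I\<^esub> y) ` {y \<in> traces_from I \<delta> \<beta>. trace_length y = n} \<subseteq>
        {y \<in> traces_from I \<delta> \<alpha>. trace_length y = n + trace_length x}"
      using x by (auto simp: traces_from_def trace_mult_closed total_action_mult trace_length_mult)
  qed (rule finite_traces_from)
  then show ?thesis by (simp add: growth_series_def)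
qed

text \<open>The points reachable from \<open>\<alpha>\<close> form a sub-action, which by
  irreducibility is the whole set.\<close>

lemma irreducible_reachable:
  assumes "irreducible_action \<delta>"
  shows "traces_between I \<delta> \<alpha> \<beta> \<noteq> {}"
proof -
  let ?Y = "{\<beta>. traces_between I \<delta> \<alpha> \<beta> \<noteq> {}}"
  have eq: "\<beta> \<in> ?Y \<longleftrightarrow> (\<exists>u. foldl (letter_step \<delta>) (Some \<alpha>) u = Some \<beta>)" for \<beta>
    by (auto simp: traces_between_def carrier_trace_monoid total_action_word)
  have "sub_action \<delta> ?Y"
    unfolding sub_action_def
  proof (intro conjI ballI)
    have "\<alpha> \<in> ?Y" unfolding eq by (intro exI[of _ "[]"]) simp
    then show "?Y \<noteq> {}" by blast
  next
    fix \<beta> a assume "\<beta> \<in> ?Y" "a \<in> dom (\<delta> \<beta>)"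
    then obtain u where "foldl (letter_step \<delta>) (Some \<alpha>) u = Some \<beta>" unfolding eq by blast
    then show "the (\<delta> \<beta> a) \<in> ?Y"
      using \<open>a \<in> dom (\<delta> \<beta>)\<close> unfolding eq
      by (intro exI[of _ "u @ [a]"]) (auto simp: letter_step_def)
  qed
  then have "?Y = UNIV" using assms by (simp add: irreducible_action_def)
  then show ?thesis by blast
qed

text \<open>Shifting the index by the length of a connecting trace costs only the constant factor
  \<open>r ^ ?k\<close>. Exchanging \<open>\<alpha>\<close> and \<open>\<beta>\<close> then gives
  equality.\<close>

lemma fps_conv_radius_growth_mono:
  assumes "irreducible_action \<delta>"
  shows "fps_conv_radius (growth_series I \<delta> \<alpha>) \<le> fps_conv_radius (growth_series I \<delta> \<beta>)"
  unfolding fps_conv_radius_def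
proof (rule conv_radius_geI_ex')
  fix r :: real assume r: "0 < r" "ereal r < conv_radius (fps_nth (growth_series I \<delta> \<alpha>))"
  obtain x where x: "x \<in> traces_between I \<delta> \<alpha> \<beta>"
    using irreducible_reachable[OF assms] by blast
  let ?k = "trace_length x"
  have "summable (\<lambda>n. fps_nth (growth_series I \<delta> \<alpha>) n * r ^ n)"
    using r by (intro summable_in_conv_radius) simp
  then have "summable (\<lambda>n. fps_nth (growth_series I \<delta> \<alpha>) (n + ?k) * r ^ (n + ?k) / r ^ ?k)"
    by (intro summable_divide summable_ignore_initial_segment)
  then show "summable (\<lambda>n. fps_nth (growth_series I \<delta> \<beta>) n * of_real r ^ n)"
  proof (rule summable_comparison_test')
    fix n
    show "norm (fps_nth (growth_series I \<delta> \<beta>) n * of_real r ^ n) \<le>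
        fps_nth (growth_series I \<delta> \<alpha>) (n + ?k) * r ^ (n + ?k) / r ^ ?k"
      using growth_series_shift[OF x, of n] r(1)
      by (simp add: power_add growth_series_nonneg)
  qed
qed

text \<open>The lower bound comes from comparison with the geometric series counting all words, the
  upper one from coefficients that do not tend to 0.\<close>

lemma fps_conv_radius_growth_bounds:
  "ereal (1 / real CARD('a)) \<le> fps_conv_radius (growth_series I \<delta> \<alpha>)"
  "fps_conv_radius (growth_series I \<delta> \<alpha>) \<le> 1"
proof -
  show "ereal (1 / real CARD('a)) \<le> fps_conv_radius (growth_series I \<delta> \<alpha>)"
    unfolding fps_conv_radius_def
  proof (rule conv_radius_geI_ex')
    fix r :: real assume r: "0 < r" "ereal r < ereal (1 / real CARD('a))"
    then have "summable (\<lambda>n. (real CARD('a) * r) ^ n)"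
      by (intro summable_geometric) (simp add: field_simps)
    then show "summable (\<lambda>n. fps_nth (growth_series I \<delta> \<alpha>) n * of_real r ^ n)"
    proof (rule summable_comparison_test')
      fix n
      show "norm (fps_nth (growth_series I \<delta> \<alpha>) n * of_real r ^ n) \<le> (real CARD('a) * r) ^ n"
        using growth_series_le[of \<alpha> n] r(1)
        by (simp add: growth_series_nonneg power_mult_distrib)
    qed
  qed
  have "\<not> summable (\<lambda>n. fps_nth (growth_series I \<delta> \<alpha>) n * 1 ^ n)"
  proof
    assume "summable (\<lambda>n. fps_nth (growth_series I \<delta> \<alpha>) n * 1 ^ n)"
    then have "(\<lambda>n. fps_nth (growth_series I \<delta> \<alpha>) n) \<longlonglongrightarrow> 0"
      using summable_LIMSEQ_zero by fastforce
    then have "1 \<le> (0 :: real)"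
      by (rule LIMSEQ_le_const) (use growth_series_ge_1 in auto)
    then show False by simp
  qed
  then have "conv_radius (fps_nth (growth_series I \<delta> \<alpha>)) \<le> norm (1 :: real)"
    by (rule conv_radius_leI')
  then show "fps_conv_radius (growth_series I \<delta> \<alpha>) \<le> 1"
    by (simp add: fps_conv_radius_def one_ereal_def)
qed

text \<open>The bounds make each radius a positive real, and monotonicity in both directions makes
  it the same for all points. Hence the definite description denotes this radius.\<close>

lemma characteristic_root_properties:
  assumes "irreducible_action \<delta>"
  shows "fps_conv_radius (growth_series I \<delta> \<alpha>) = ereal (characteristic_root I \<delta>)"
    and "characteristic_root I \<delta> > 0"
proof -
  have "fps_conv_radius (growth_series I \<delta> \<alpha>) \<in> {ereal (1 / real CARD('a))..1}"
    using fps_conv_radius_growth_bounds by simp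
  then obtain t where t: "fps_conv_radius (growth_series I \<delta> \<alpha>) = ereal t" "1 / real CARD('a) \<le> t"
    by (cases "fps_conv_radius (growth_series I \<delta> \<alpha>)") auto
  have all: "fps_conv_radius (growth_series I \<delta> \<beta>) = ereal t" for \<beta>
    using t(1) fps_conv_radius_growth_mono[OF assms] by (metis order_antisym)
  have "characteristic_root I \<delta> = t"
    unfolding characteristic_root_def by (rule the_equality) (auto simp: all)
  then show "fps_conv_radius (growth_series I \<delta> \<alpha>) = ereal (characteristic_root I \<delta>)"
    "characteristic_root I \<delta> > 0"
    using t by (auto intro: less_le_trans[of _ "1 / real CARD('a)"])
qed

end

subsection \<open>The characteristic root\<close>

text \<open>A partial sum at \<open>t\<close> is the limit of the partial sums at
  \<open>r < t\<close>, and by nonnegativity these stay below the full sums, hence below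
  \<open>B\<close>.\<close>

lemma summable_of_power_series_bound:
  fixes a :: "nat \<Rightarrow> real"
  assumes nonneg: "\<And>n. a n \<ge> 0" and t: "t > 0"
    and bound: "eventually (\<lambda>r. summable (\<lambda>n. a n * r ^ n) \<and> (\<Sum>n. a n * r ^ n) \<le> B) (at_left t)"
  shows "summable (\<lambda>n. a n * t ^ n)"
proof (rule bounded_imp_summable)
  fix N
  have "((\<lambda>r. \<Sum>n\<le>N. a n * r ^ n) \<longlongrightarrow> (\<Sum>n\<le>N. a n * t ^ n)) (at_left t)"
    by (intro tendsto_intros)
  moreover have "eventually (\<lambda>r. (\<Sum>n\<le>N. a n * r ^ n) \<le> B) (at_left t)"
    using bound eventually_at_left_real[OF t]
  proof eventually_elim
    case (elim r)
    have "(\<Sum>n\<le>N. a n * r ^ n) \<le> (\<Sum>n. a n * r ^ n)"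
      using elim nonneg by (intro sum_le_suminf) auto
    then show ?case using elim by simp
  qed
  ultimately show "(\<Sum>n\<le>N. a n * t ^ n) \<le> B"
    by (rule tendsto_upperbound) simp
qed (use nonneg t in auto)

context trace_action
begin

lemma theta_characteristic_root:
  assumes irr: "irreducible_action \<delta>"
  shows "det (mu_eval I \<delta> (of_real (characteristic_root I \<delta>))) = 0"
proof (rule ccontr)
  define t where "t = characteristic_root I \<delta>"
  define F where "F = (\<lambda>\<alpha> z. cramer_numerator \<alpha> z / det (mu_eval I \<delta> z))"
  let ?g = "\<lambda>\<alpha>. fps_nth (growth_series I \<delta> \<alpha>)"
  let ?h = "\<lambda>\<alpha> n. of_real (?g \<alpha> n) :: complex"
  have t: "t > 0" and radius: "fps_conv_radius (growth_series I \<delta> \<alpha>) = ereal t" for \<alpha>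
    using characteristic_root_properties[OF irr] by (simp_all add: t_def)
  assume "det (mu_eval I \<delta> (of_real (characteristic_root I \<delta>))) \<noteq> 0"
  then have nz: "det (mu_eval I \<delta> (of_real t)) \<noteq> 0" by (simp add: t_def)
  have det_hol: "(\<lambda>z. det (mu_eval I \<delta> z)) holomorphic_on S" for S
    by (intro holomorphic_on_det holomorphic_mu_eval)
  have inside: "summable (\<lambda>n. ?g \<alpha> n * r ^ n)" if "0 < r" "r < t" for r \<alpha>
    using that radius[of \<alpha>] by (intro summable_in_conv_radius) (simp add: fps_conv_radius_def)
  \<comment> \<open>The series has real values at real \<open>r\<close>, so taking real parts loses
    nothing.\<close>
  have sums: "(\<lambda>n. ?g \<alpha> n * r ^ n) sums Re (F \<alpha> (of_real r))" if r: "0 < r" "r < t" for r \<alpha>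
    using sums_Re[OF growth_series_sums[OF inside[OF r], of "of_real r" \<alpha>]] r
    by (simp add: F_def flip: of_real_power of_real_mult)

  have boundary: "summable (\<lambda>n. ?g \<alpha> n * t ^ n)" for \<alpha>
  proof (rule summable_of_power_series_bound[OF growth_series_nonneg t])
    have cont: "isCont f z" if "f holomorphic_on UNIV" for f :: "complex \<Rightarrow> complex" and z
      using holomorphic_on_imp_continuous_on[OF that] by (simp add: continuous_on_eq_continuous_at)
    \<comment> \<open>Here the assumption that the determinant is nonzero at \<open>t\<close>
      enters: the quotient is continuous there, hence bounded just to the left of
      \<open>t\<close>.\<close>
    have "isCont (F \<alpha>) (of_real t)"
      unfolding F_def using nz
      by (intro continuous_intros cont det_hol holomorphic_cramer_numerator) auto
    then have "((\<lambda>r. F \<alpha> (of_real r)) \<longlongrightarrow> F \<alpha> (of_real t)) (at_left t)"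
      by (rule isCont_tendsto_compose) (intro tendsto_intros)
    then have "((\<lambda>r. Re (F \<alpha> (of_real r))) \<longlongrightarrow> Re (F \<alpha> (of_real t))) (at_left t)"
      by (rule tendsto_Re)
    then have "eventually (\<lambda>r. Re (F \<alpha> (of_real r)) < Re (F \<alpha> (of_real t)) + 1) (at_left t)"
      by (rule order_tendstoD) simp
    then show "eventually (\<lambda>r. summable (\<lambda>n. ?g \<alpha> n * r ^ n) \<and>
        (\<Sum>n. ?g \<alpha> n * r ^ n) \<le> Re (F \<alpha> (of_real t)) + 1) (at_left t)"
      using eventually_at_left_real[OF t]
    proof eventually_elim
      case (elim r)
      then show ?case using sums[of r \<alpha>] by (auto simp: sums_iff)
    qed
  qed

  define U where "U = {z. det (mu_eval I \<delta> z) \<noteq> 0}"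
  have "open ((\<lambda>z. det (mu_eval I \<delta> z)) -` (- {0}))"
    using holomorphic_on_imp_continuous_on[OF det_hol[of UNIV]]
    by (intro open_vimage) auto
  then have "open U" by (simp add: U_def vimage_def)
  \<comment> \<open>Convergence at \<open>t\<close> itself excludes zeros on the boundary circle
    too, so a compact set lies in the open set \<open>U\<close>.\<close>
  moreover have "cball 0 t \<subseteq> U"
    using theta_nonzero[OF boundary] by (auto simp: U_def)
  ultimately obtain e where e: "e > 0" "(\<Union>z\<in>cball 0 t. ball z e) \<subseteq> U"
    using compact_subset_open_imp_ball_epsilon_subset[of "cball 0 t" U] by auto
  have ball: "ball 0 (t + e) \<subseteq> U"
  proof
    fix z :: complex assume z: "z \<in> ball 0 (t + e)"
    have "z \<in> (\<Union>z\<in>cball 0 t. ball z e)"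
    proof (cases "norm z \<le> t")
      case True
      then show ?thesis using e by (intro UN_I[of z]) auto
    next
      case False
      \<comment> \<open>The radial projection of \<open>z\<close> to the circle of radius
        \<open>t\<close>; its distance from \<open>z\<close> is \<open>norm z - t\<close>, which is
        less than \<open>e\<close>.\<close>
      define w where "w = of_real (t / norm z) * z"
      have "z \<noteq> 0" using False t by auto
      have w: "norm w = t" using False t by (auto simp: w_def norm_mult norm_divide)
      have "w - z = of_real (t / norm z - 1) * z" by (simp add: w_def algebra_simps)
      then have "dist w z = \<bar>t / norm z - 1\<bar> * norm z"
        by (simp only: dist_norm norm_mult norm_of_real)
      moreover have "\<bar>t / norm z - 1\<bar> = 1 - t / norm z"
        using False t \<open>z \<noteq> 0\<close> by (simp add: field_simps)
      ultimately have "dist w z = norm z - t" using \<open>z \<noteq> 0\<close> by (simp add: left_diff_distrib)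
      then show ?thesis using w z by (intro UN_I[of w]) auto
    qed
    then show "z \<in> U" using e by blast
  qed
  \<comment> \<open>The radius depends only on the norms of the coefficients, so it is unchanged in
    passing to complex ones.\<close>
  have h_radius: "conv_radius (?h \<alpha>) = ereal t" for \<alpha>
  proof -
    have "conv_radius (?h \<alpha>) = conv_radius (\<lambda>n. norm (?h \<alpha> n))"
      by (rule conv_radius_norm[symmetric])
    also have "\<dots> = conv_radius (\<lambda>n. norm (?g \<alpha> n))" by (simp only: norm_of_real real_norm_def)
    also have "\<dots> = conv_radius (?g \<alpha>)" by (rule conv_radius_norm)
    finally show ?thesis using radius[of \<alpha>] by (simp add: fps_conv_radius_def)
  qed
  \<comment> \<open>Agreement on the disk of radius \<open>t\<close> identifies the growth series as
    the Taylor expansion of \<open>F \<alpha>\<close> at 0.\<close>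
  have expansion: "F \<alpha> has_fps_expansion Abs_fps (?h \<alpha>)" for \<alpha>
  proof -
    have "eventually (\<lambda>z. z \<in> ball 0 t) (nhds (0::complex))"
      using t by (intro eventually_nhds_in_open) auto
    then have "eventually (\<lambda>z. eval_fps (Abs_fps (?h \<alpha>)) z = F \<alpha> z) (nhds 0)"
    proof eventually_elim
      case (elim z)
      then show ?case
        using growth_series_sums[OF boundary, of z \<alpha>] by (simp add: F_def eval_fps_def sums_iff)
    qed
    then show ?thesis
      using t h_radius[of \<alpha>] by (simp add: has_fps_expansion_def fps_conv_radius_def)
  qed
  have "F \<alpha> holomorphic_on eball 0 (ereal (t + e))" for \<alpha>
    unfolding F_def using ball
    by (intro holomorphic_on_divide holomorphic_cramer_numerator det_hol) (auto simp: U_def)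
  \<comment> \<open>A function holomorphic on the larger disk has a Taylor series converging there,
    which exceeds the radius \<open>t\<close>.\<close>
  then have "ereal (t + e) \<le> fps_conv_radius (Abs_fps (?h \<alpha>))" for \<alpha>
    by (rule holomorphic_on_imp_fps_conv_radius_ge[OF expansion])
  then show False using h_radius e(1) by (simp add: fps_conv_radius_def)
qed

end

theorem theorem5:
  fixes I :: "('a::finite \<times> 'a) set"
    and \<delta> :: "'x::finite \<Rightarrow> 'a \<rightharpoonup> 'x"
  assumes "CARD('a) \<ge> 2"
    and "irrefl I" and "sym I"
    and "partial_action I \<delta>"
    and "irreducible_action \<delta>"
  shows "characteristic_root I \<delta> > 0
    \<and> poly (map_poly real_of_int (theta I \<delta>)) (characteristic_root I \<delta>) = 0
    \<and> (\<forall>t>0. poly (map_poly real_of_int (theta I \<delta>)) t = 0 \<longrightarrow> characteristic_root I \<delta> \<le> t)"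
proof -
  interpret trace_action I \<delta> by unfold_locales (use assms in auto)
  \<comment> \<open>The embedding \<open>of_real\<close> is injective, so a real zero may be tested
    on the complex determinant.\<close>
  have theta: "poly (map_poly real_of_int (theta I \<delta>)) t = 0 \<longleftrightarrow> det (mu_eval I \<delta> (of_real t)) = 0" for t
    by (simp add: poly_of_int_of_real flip: theta_eval)
  show ?thesis
  proof (intro conjI allI impI)
    show "characteristic_root I \<delta> > 0"
      by (rule characteristic_root_properties[OF assms(5)])
    show "poly (map_poly real_of_int (theta I \<delta>)) (characteristic_root I \<delta>) = 0"
      unfolding theta by (rule theta_characteristic_root[OF assms(5)])
  next
    fix t :: real
    assume t: "t > 0" "poly (map_poly real_of_int (theta I \<delta>)) t = 0"
    show "characteristic_root I \<delta> \<le> t"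
    proof (rule ccontr)
      assume "\<not> characteristic_root I \<delta> \<le> t"
      \<comment> \<open>A smaller positive zero would lie inside the disk of convergence, where the
        determinant does not vanish.\<close>
      then have "summable (\<lambda>n. fps_nth (growth_series I \<delta> \<alpha>) n * t ^ n)" for \<alpha>
        using t(1) characteristic_root_properties(1)[OF assms(5), of \<alpha>]
        by (intro summable_in_conv_radius) (simp add: fps_conv_radius_def)
      then have "det (mu_eval I \<delta> (of_real t)) \<noteq> 0"
        by (rule theta_nonzero) (use t(1) in simp)
      then show False using t(2) by (simp add: theta)
    qed
  qed
qed

end
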